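(* Let $n\geq 1$ and let $M\in\mathbb{R}_{\geq 0}^{n\times n}$ be a primitive matrix with positive diagonal entries. Then there exists a unique vector $\mathbf{x}=(x_1,\dots,x_n)^t$ with positive entries such that $M\mathbf{x}=\left(\frac{1}{x_1},\dots,\frac{1}{x_n}\right)^t$.
   Context: A primitive matrix is a square matrix with nonnegative real entries some power of which has all entries positive. *)

theory Defs
  imports "HOL-Analysis.Analysis"
begin

(* The componentwise product makes real^'n^'n an instance of class power, so M ^ k would
   denote entrywise powers. Powers with respect to ** are therefore defined separately. *)
primrec matrix_pow :: "real^'n^'n \<Rightarrow> nat \<Rightarrow> real^'n^'n" where
  "matrix_pow M 0 = mat 1"
| "matrix_pow M (Suc k) = M ** matrix_pow M k"

(* The exponent is required to be positive, since the zeroth power would make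
   the 1 x 1 zero matrix primitive. *)
definition primitive_matrix :: "real^'n^'n \<Rightarrow> bool" where
  "primitive_matrix M \<longleftrightarrow>
     (\<forall>i j. M $ i $ j \<ge> 0) \<and> (\<exists>k\<ge>1. \<forall>i j. matrix_pow M k $ i $ j > 0)"

end

theory Submission
  imports Defs
begin

text \<open>
  Existence: the equation for the \<open>i\<close>-th coordinate is a quadratic equation in \<open>x\<^sub>i\<close> with
  leading coefficient \<open>M\<^sub>i\<^sub>i > 0\<close>, whose positive root depends continuously on the other
  coordinates and is at most \<open>1 / sqrt M\<^sub>i\<^sub>i\<close>. Brouwer's theorem on the box of these bounds yields a
  solution. Uniqueness: for solutions \<open>x\<close>, \<open>y\<close> let \<open>u\<close> and \<open>l\<close> be the largest and the smallest
  ratio \<open>y\<^sub>k / x\<^sub>k\<close>. If \<open>l < u\<close>, the positive diagonal forces \<open>l u < 1\<close> at the maximal ratio and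
  \<open>1 < l u\<close> at the minimal one; so \<open>y\<close> is a multiple of \<open>x\<close>, and the factor is 1.
\<close>

text \<open>The off-diagonal summands are nonnegative. The vectors \<open>z\<close> to which this is
  applied are differences such as \<open>y - l x\<close>, nonnegative by the choice of
  \<open>l\<close>.\<close>

lemma diagonal_term_le_mult_vec:
  fixes M :: "real^'n^'n"
  assumes "\<And>i j. 0 \<le> M $ i $ j" and "\<And>j. 0 \<le> z $ j"
  shows "M $ i $ i * z $ i \<le> (M *v z) $ i"
  using assms by (auto simp: matrix_vector_mult_def intro!: member_le_sum)

text \<open>The formula is the rationalised form of
  \<open>(- s + sqrt (s^2 + 4 * m)) / (2 * m)\<close>; since \<open>s\<close> occurs only in the
  denominator, the upper bound, attained at \<open>s = 0\<close>, can be read off.\<close>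

lemma positive_root_quadratic:
  fixes m s x :: real
  assumes "m > 0" and "s \<ge> 0" and x: "x = 2 / (s + sqrt (s\<^sup>2 + 4 * m))"
  shows "0 < x" and "x \<le> 1 / sqrt m" and "(m * x + s) * x = 1"
proof -
  define r where "r = sqrt (s\<^sup>2 + 4 * m)"
  have "sqrt (4 * m) \<le> r"
    unfolding r_def by (intro real_sqrt_le_mono) auto
  then have r: "2 * sqrt m \<le> r"
    by (simp add: real_sqrt_mult)
  have sm: "0 < sqrt m"
    using assms by simp
  have pos: "0 < s + r"
    using r sm assms(2) by linarith
  then show "0 < x"
    using x by (simp add: r_def)
  have "x \<le> 2 / (2 * sqrt m)"
    unfolding x r_def[symmetric] using r sm pos assms(2) by (intro divide_left_mono) auto
  then show "x \<le> 1 / sqrt m"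
    by simp
  have "x * (s + r) = 2"
    using pos unfolding x r_def[symmetric] by (simp add: divide_eq_eq)
  then have "x * r = 2 - x * s"
    by (simp add: algebra_simps)
  \<comment> \<open>Squaring removes the root; the terms \<open>x^2 * s^2\<close> then
    cancel.\<close>
  then have "x\<^sup>2 * r\<^sup>2 = (2 - x * s)\<^sup>2"
    by (metis power_mult_distrib)
  moreover have "r\<^sup>2 = s\<^sup>2 + 4 * m"
    using assms by (simp add: r_def)
  ultimately have "x\<^sup>2 * (s\<^sup>2 + 4 * m) = (2 - x * s)\<^sup>2"
    by simp
  then show "(m * x + s) * x = 1"
    by (simp add: power2_eq_square algebra_simps)
qed

lemma exists_inverse_fixed_vector:
  fixes M :: "real^'n^'n"
  assumes nonneg: "\<And>i j. 0 \<le> M $ i $ j" and diag: "\<And>i. 0 < M $ i $ i"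
  shows "\<exists>x :: real^'n. (\<forall>i. 0 < x $ i) \<and> M *v x = (\<chi> i. 1 / x $ i)"
proof -
  \<comment> \<open>\<open>s x i\<close> is the off-diagonal part of row \<open>i\<close>.
    \<open>F\<close> solves each equation for its own coordinate with the others frozen, so its
    fixed points are the solutions.\<close>
  define s :: "real^'n \<Rightarrow> 'n \<Rightarrow> real" where "s x i = (\<Sum>j\<in>UNIV - {i}. M $ i $ j * x $ j)" for x i
  define F :: "real^'n \<Rightarrow> real^'n"
    where "F x = (\<chi> i. 2 / (s x i + sqrt ((s x i)\<^sup>2 + 4 * M $ i $ i)))" for x
  define B :: "(real^'n) set" where "B = cbox 0 (\<chi> i. 1 / sqrt (M $ i $ i))"
  have mem_B: "x \<in> B \<longleftrightarrow> (\<forall>i. 0 \<le> x $ i \<and> x $ i \<le> 1 / sqrt (M $ i $ i))" for x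
    by (simp add: B_def mem_box_cart)
  have s_nonneg: "0 \<le> s x i" if "x \<in> B" for x i
    unfolding s_def using that nonneg by (auto simp: mem_B intro!: sum_nonneg)
  have root: "0 < F x $ i" "F x $ i \<le> 1 / sqrt (M $ i $ i)"
    "(M $ i $ i * F x $ i + s x i) * F x $ i = 1" if "x \<in> B" for x i
    using positive_root_quadratic[OF diag s_nonneg[OF that], of "F x $ i" i i] by (auto simp: F_def)
  have "0 \<in> B"
    using diag by (simp add: mem_B less_imp_le)
  then have "B \<noteq> {}"
    by blast
  \<comment> \<open>Division by zero yields 0, so a vanishing denominator would contradict
    \<open>0 < F x $ i\<close>.\<close>
  have denom: "s x i + sqrt ((s x i)\<^sup>2 + 4 * M $ i $ i) \<noteq> 0" if "x \<in> B" for x i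
  proof
    assume "s x i + sqrt ((s x i)\<^sup>2 + 4 * M $ i $ i) = 0"
    then show False
      using root(1)[OF that, of i] by (simp add: F_def)
  qed
  have "continuous_on B (\<lambda>x. s x i)" for i
    unfolding s_def by (intro continuous_intros)
  then have "continuous_on B F"
    unfolding F_def using denom by (intro continuous_intros) auto
  moreover have "F \<in> B \<rightarrow> B"
    using root by (auto simp: mem_B less_imp_le)
  moreover have "compact B" "convex B"
    by (simp_all add: B_def)
  ultimately obtain x where x: "x \<in> B" "F x = x"
    using \<open>B \<noteq> {}\<close> by (elim brouwer[rotated 3])
  have "(M *v x) $ i = M $ i $ i * x $ i + s x i" for i
    unfolding s_def matrix_vector_mult_def by (simp add: sum.remove[of UNIV i])
  then have "(M *v x) $ i = 1 / x $ i" for i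
    using root(1,3)[OF x(1), of i] x(2) by (simp add: field_simps)
  then show ?thesis
    using root(1)[OF x(1)] x(2) by (metis vec_eq_iff vec_lambda_beta)
qed

lemma inverse_fixed_vector_unique:
  fixes M :: "real^'n^'n" and x y :: "real^'n"
  assumes nonneg: "\<And>i j. 0 \<le> M $ i $ j" and diag: "\<And>i. 0 < M $ i $ i"
    and x: "\<And>i. 0 < x $ i" "\<And>i. (M *v x) $ i = 1 / x $ i"
    and y: "\<And>i. 0 < y $ i" "\<And>i. (M *v y) $ i = 1 / y $ i"
  shows "x = y"
proof -
  define q where "q k = y $ k / x $ k" for k
  have "Max (range q) \<in> range q"
    by (intro Max_in) auto
  then obtain i where qi: "Max (range q) = q i"
    by blast
  have i: "q k \<le> q i" for k
    unfolding qi[symmetric] by (intro Max_ge) auto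
  have "Min (range q) \<in> range q"
    by (intro Min_in) auto
  then obtain j where qj: "Min (range q) = q j"
    by blast
  have j: "q j \<le> q k" for k
    unfolding qj[symmetric] by (intro Min_le) auto
  have y_eq: "y $ k = q k * x $ k" for k
    using x(1)[of k] by (simp add: q_def)
  have q_pos: "0 < q k" for k
    using x(1) y(1) by (simp add: q_def)
  \<comment> \<open>The right side is coordinate \<open>i\<close> of
    \<open>M *v (y - q j *\<^sub>R x)\<close>, by the two equations and
    \<open>y $ i = q i * x $ i\<close>.\<close>
  have at_max: "M $ i $ i * ((q i - q j) * x $ i) \<le> (1 / q i - q j) / x $ i"
  proof -
    have "M $ i $ i * (y - q j *\<^sub>R x) $ i \<le> (M *v (y - q j *\<^sub>R x)) $ i"
      using nonneg j x(1) by (intro diagonal_term_le_mult_vec) (auto simp: y_eq mult_right_mono less_imp_le)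
    then show ?thesis
      using x(2)[of i] y(2)[of i]
      by (simp add: matrix_vector_mult_diff_distrib matrix_vector_mult_scaleR y_eq diff_divide_distrib algebra_simps)
  qed
  have at_min: "M $ j $ j * ((q i - q j) * x $ j) \<le> (q i - 1 / q j) / x $ j"
  proof -
    have "M $ j $ j * (q i *\<^sub>R x - y) $ j \<le> (M *v (q i *\<^sub>R x - y)) $ j"
      using nonneg i x(1) by (intro diagonal_term_le_mult_vec) (auto simp: y_eq mult_right_mono less_imp_le)
    then show ?thesis
      using x(2)[of j] y(2)[of j]
      by (simp add: matrix_vector_mult_diff_distrib matrix_vector_mult_scaleR y_eq diff_divide_distrib algebra_simps)
  qed
  have "q i = q j"
  proof (rule ccontr)
    assume "q i \<noteq> q j"
    then have less: "q j < q i"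
      using j[of i] by simp
    have "0 < (1 / q i - q j) / x $ i"
      by (rule less_le_trans[OF _ at_max]) (use less diag x(1) in simp)
    moreover have "0 < (q i - 1 / q j) / x $ j"
      by (rule less_le_trans[OF _ at_min]) (use less diag x(1) in simp)
    ultimately have "q j < 1 / q i" "1 / q j < q i"
      using x(1)[of i] x(1)[of j] by (auto simp: zero_less_divide_iff)
    \<comment> \<open>Multiplying by \<open>q i\<close> and \<open>q j\<close> respectively gives
      \<open>q i * q j < 1\<close> and \<open>1 < q i * q j\<close>.\<close>
    then show False
      using q_pos[of i] q_pos[of j] by (simp add: field_simps)
  qed
  then have q_const: "q k = q i" for k
    using i[of k] j[of k] by simp
  \<comment> \<open>For equal ratios the left sides of \<open>at_max\<close> and
    \<open>at_min\<close> vanish, and what remains bounds \<open>q i\<close> against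
    \<open>1 / q i\<close> from both sides.\<close>
  have "0 \<le> (1 / q i - q i) / x $ i" "0 \<le> (q i - 1 / q i) / x $ j"
    using at_max at_min \<open>q i = q j\<close> by simp_all
  then have "1 / q i = q i"
    using x(1)[of i] x(1)[of j] by (auto simp: zero_le_divide_iff)
  then have "(q i)\<^sup>2 = 1"
    using q_pos[of i] by (simp add: field_simps power2_eq_square)
  then have "q i = 1"
    using q_pos[of i] by (simp add: power2_eq_1_iff)
  then show "x = y"
    using y_eq q_const by (simp add: vec_eq_iff)
qed

theorem theorem1:
  fixes M :: "real^'n^'n"
  assumes "primitive_matrix M"
    and "\<forall>i. M $ i $ i > 0"
  shows "\<exists>!x :: real^'n. (\<forall>i. x $ i > 0) \<and> M *v x = (\<chi> i. 1 / x $ i)"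
proof -
  have nonneg: "0 \<le> M $ i $ j" for i j
    using assms(1) by (simp add: primitive_matrix_def)
  show ?thesis
  proof (rule ex_ex1I)
    show "\<exists>x :: real^'n. (\<forall>i. x $ i > 0) \<and> M *v x = (\<chi> i. 1 / x $ i)"
      using nonneg assms(2) by (simp add: exists_inverse_fixed_vector)
  next
    fix x y :: "real^'n"
    assume "(\<forall>i. x $ i > 0) \<and> M *v x = (\<chi> i. 1 / x $ i)"
      and "(\<forall>i. y $ i > 0) \<and> M *v y = (\<chi> i. 1 / y $ i)"
    then show "x = y"
      using nonneg assms(2) by (intro inverse_fixed_vector_unique[of M]) auto
  qed
qed

end
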